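(* Let $\mathcal{L}$ be an arbitrary finite meet-semilattice, $P$ the set of join-irreducible elements of $\mathcal{L}$, and $K$ a field. Then the Stanley–Reisner ideal $I_{\Gamma_{\mathcal{L}}}\subset K[\{x_p,y_p\}_{p\in P}]$ of the Alexander dual $\Gamma_{\mathcal{L}}$ of $\mathcal{L}$ is generated by the following squarefree monomials: (i) $x_p y_q$, where $p,q\in P$ with $p\le q$; (ii) $\prod_{q\in B}y_q$, where $B$ is an antichain of $P$ with $\langle B\rangle\not\subset\ell(\alpha)$ for all $\alpha\in\mathcal{L}$; (iii) $x_p\prod_{q\in B}y_q$, where $B$ is an antichain of $P$ with $\ell(\beta)\ne\langle B\rangle$ for all $\beta\in\mathcal{L}$, but with $\langle B\rangle\subset\ell(\alpha)$ for some $\alpha\in\mathcal{L}$, and where $p\in\ell\bigl(\bigwedge_{\langle B\rangle\subset\ell(\alpha)}\alpha\bigr)\setminus\langle B\rangle$ (the meet being over all $\alpha\in\mathcal{L}$ with $\langle B\rangle\subset\ell(\alpha)$).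
   Context: Let $\mathcal{L}$ be a finite meet-semilattice with unique minimal element $\hat 0$. A join-irreducible element of $\mathcal{L}$ is one that covers exactly one element of $\mathcal{L}$ (so $\hat 0$ is not join-irreducible). $P\subset\mathcal{L}$ is the set of join-irreducible elements with the induced order, and $\ell(\alpha)=\{p\in P : p\le\alpha\}$ for $\alpha\in\mathcal{L}$. For a subset $B\subset P$, $\langle B\rangle=\{p\in P : p\le q\text{ for some }q\in B\}$ is the poset ideal of $P$ generated by $B$. $K[\mathbf{x},\mathbf{y}]=K[\{x_p,y_p\}_{p\in P}]$ is the polynomial ring in $2|P|$ variables over $K$. For $\alpha\in\mathcal{L}$ put $u_\alpha=\prod_{p\in\ell(\alpha)}x_p\prod_{p\in P\setminus\ell(\alpha)}y_p$. Let $\Sigma_{\mathcal{L}}$ be the simplicial complex on the vertex set $\{x_p,y_p\}_{p\in P}$ whose Stanley–Reisner ideal is $H_{\mathcal{L}}=(u_\alpha)_{\alpha\in\mathcal{L}}$. The Alexander dual $\Gamma_{\mathcal{L}}$ of $\mathcal{L}$ is the Alexander dual of $\Sigma_{\mathcal{L}}$, i.e. the simplicial complex of complements of nonfaces of $\Sigma_{\mathcal{L}}$; equivalently, the simplicial complex whose facets are the sets $F_\alpha=\{x_q : q\in P\setminus\ell(\alpha)\}\cup\{y_q : q\in\ell(\alpha)\}$, $\alpha\in\mathcal{L}$. *)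

theory Defs
  imports "HOL-Algebra.Ideal" "HOL-Library.Poly_Mapping"
begin

section \<open>Polynomial rings in several variables\<close>

text \<open>
  Polynomials over \<open>'k\<close> with variables from the type \<open>'v\<close> are finitely supported maps from
  monomials (finitely supported exponent vectors) to coefficients; sum and product are those of
  \<^theory>\<open>HOL-Library.Poly_Mapping\<close>.  The ring \<open>K[V]\<close> consists of the polynomials in which
  only variables from \<open>V\<close> occur.
\<close>

type_synonym ('v, 'k) mpoly = "('v \<Rightarrow>\<^sub>0 nat) \<Rightarrow>\<^sub>0 'k"

definition pvar :: "'v \<Rightarrow> ('v, 'k::field) mpoly" where
  "pvar v = Poly_Mapping.single (Poly_Mapping.single v 1) 1"

definition mpoly_ring :: "'v set \<Rightarrow> ('v, 'k::field) mpoly ring" where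
  "mpoly_ring V = \<lparr>carrier = {f. \<forall>m\<in>Poly_Mapping.keys f. Poly_Mapping.keys m \<subseteq> V},
     monoid.mult = (*), one = 1, zero = 0, add = (+)\<rparr>"

lemma mpoly_ring_simps [simp]:
  "f \<in> carrier (mpoly_ring V) \<longleftrightarrow>
     (\<forall>m\<in>Poly_Mapping.keys f. Poly_Mapping.keys m \<subseteq> V)"
  "monoid.mult (mpoly_ring V) = (*)" "one (mpoly_ring V) = 1"
  "zero (mpoly_ring V) = 0" "add (mpoly_ring V) = (+)"
  by (simp_all add: mpoly_ring_def)

lemma keys_add_nat:
  fixes m n :: "'v \<Rightarrow>\<^sub>0 nat"
  shows "Poly_Mapping.keys (m + n) = Poly_Mapping.keys m \<union> Poly_Mapping.keys n"
  by (auto simp: in_keys_iff lookup_add)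

lemma keys_multE:
  fixes f g :: "('v, 'k::field) mpoly"
  assumes "m \<in> Poly_Mapping.keys (f * g)"
  obtains a b where "a \<in> Poly_Mapping.keys f" "b \<in> Poly_Mapping.keys g" "m = a + b"
  using assms keys_mult[of f g] by blast

lemma cring_mpoly_ring: "cring (mpoly_ring V :: ('v, 'k::field) mpoly ring)"
proof (rule cringI)
  have plus: "f + g \<in> carrier (mpoly_ring V)"
    if "f \<in> carrier (mpoly_ring V)" "g \<in> carrier (mpoly_ring V)" for f g :: "('v, 'k) mpoly"
    using that subsetD[OF keys_add[of f g]] by simp blast
  have times: "f * g \<in> carrier (mpoly_ring V)"
    if "f \<in> carrier (mpoly_ring V)" "g \<in> carrier (mpoly_ring V)" for f g :: "('v, 'k) mpoly"
  proof -
    have "Poly_Mapping.keys m \<subseteq> V" if m: "m \<in> Poly_Mapping.keys (f * g)" for m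
    proof -
      obtain a b where ab: "a \<in> Poly_Mapping.keys f" "b \<in> Poly_Mapping.keys g" "m = a + b"
        using m by (rule keys_multE)
      then have "Poly_Mapping.keys a \<subseteq> V" "Poly_Mapping.keys b \<subseteq> V"
        using \<open>f \<in> _\<close> \<open>g \<in> _\<close> by simp_all
      then show ?thesis unfolding ab(3) keys_add_nat by blast
    qed
    then show ?thesis by simp
  qed
  show "abelian_group (mpoly_ring V :: ('v, 'k) mpoly ring)"
  proof (rule abelian_groupI)
    fix f g :: "('v, 'k) mpoly"
    assume f: "f \<in> carrier (mpoly_ring V)" and g: "g \<in> carrier (mpoly_ring V)"
    show "f \<oplus>\<^bsub>mpoly_ring V\<^esub> g \<in> carrier (mpoly_ring V)"
      using plus[OF f g] by simp
  next
    fix f :: "('v, 'k) mpoly" assume f: "f \<in> carrier (mpoly_ring V)"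
    show "\<exists>g\<in>carrier (mpoly_ring V). g \<oplus>\<^bsub>mpoly_ring V\<^esub> f = \<zero>\<^bsub>mpoly_ring V\<^esub>"
      using f by (intro bexI[of _ "- f"]) auto
  qed (simp_all add: add_ac)
  show "comm_monoid (mpoly_ring V :: ('v, 'k) mpoly ring)"
  proof (rule comm_monoidI)
    fix f g :: "('v, 'k) mpoly"
    assume f: "f \<in> carrier (mpoly_ring V)" and g: "g \<in> carrier (mpoly_ring V)"
    show "f \<otimes>\<^bsub>mpoly_ring V\<^esub> g \<in> carrier (mpoly_ring V)"
      using times[OF f g] by simp
  qed (simp_all add: mult_ac)
qed (simp add: distrib_right)


section \<open>Simplicial complexes and Stanley-Reisner ideals\<close>

text \<open>
  Elements of the vertex set \<open>V\<close> need not be faces, and the void complex (without any faces,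
  as opposed to \<open>{{}}\<close>) is admitted: both occur as \<open>Sigma_complex\<close> below.
\<close>

definition simplicial_complex :: "'v set \<Rightarrow> 'v set set \<Rightarrow> bool" where
  "simplicial_complex V \<Delta> \<longleftrightarrow> \<Delta> \<subseteq> Pow V \<and> (\<forall>F\<in>\<Delta>. \<forall>G. G \<subseteq> F \<longrightarrow> G \<in> \<Delta>)"

definition stanley_reisner_ideal :: "'v set \<Rightarrow> 'v set set \<Rightarrow> ('v, 'k::field) mpoly set" where
  "stanley_reisner_ideal V \<Delta> =
     genideal (mpoly_ring V) {\<Prod>v\<in>F. pvar v | F. F \<subseteq> V \<and> F \<notin> \<Delta>}"

definition alexander_dual :: "'v set \<Rightarrow> 'v set set \<Rightarrow> 'v set set" where
  "alexander_dual V \<Delta> = {V - F | F. F \<subseteq> V \<and> F \<notin> \<Delta>}"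

lemma prod_pvar:
  assumes "finite F"
  shows "\<exists>m. (\<Prod>v\<in>F. pvar v :: ('v, 'k::field) mpoly) = Poly_Mapping.single m 1
           \<and> Poly_Mapping.keys m = F"
  using assms
proof (induction F)
  case empty
  show ?case by (intro exI[of _ 0]) auto
next
  case (insert v F)
  then obtain m where m: "(\<Prod>v\<in>F. pvar v :: ('v, 'k) mpoly) = Poly_Mapping.single m 1"
    "Poly_Mapping.keys m = F" by blast
  show ?case
    using insert.hyps m
    by (intro exI[of _ "Poly_Mapping.single v 1 + m"])
       (auto simp: pvar_def mult_single keys_add_nat)
qed

lemma keys_prod_pvar:
  assumes "finite F" "m \<in> Poly_Mapping.keys (\<Prod>v\<in>F. pvar v :: ('v, 'k::field) mpoly)"
  shows "Poly_Mapping.keys m = F"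
  using prod_pvar[OF assms(1), where 'k = 'k] assms(2) by (auto split: if_splits)

lemma prod_pvar_carrier:
  assumes "finite V" "F \<subseteq> V"
  shows "(\<Prod>v\<in>F. pvar v :: ('v, 'k::field) mpoly) \<in> carrier (mpoly_ring V)"
  using assms keys_prod_pvar[of F, where 'k = 'k] finite_subset by fastforce

lemma monomial_in_genideal_iff:
  fixes V :: "'v set"
  assumes V: "finite V" "F \<subseteq> V" and \<N>: "\<N> \<subseteq> Pow V"
  shows "(\<Prod>v\<in>F. pvar v :: ('v, 'k::field) mpoly)
            \<in> genideal (mpoly_ring V) ((\<lambda>G. \<Prod>v\<in>G. pvar v) ` \<N>)
         \<longleftrightarrow> (\<exists>G\<in>\<N>. G \<subseteq> F)" (is "?x F \<in> ?I \<longleftrightarrow> _")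
proof
  interpret cring "mpoly_ring V :: ('v, 'k) mpoly ring" by (rule cring_mpoly_ring)
  have gens: "(\<lambda>G. \<Prod>v\<in>G. pvar v) ` \<N> \<subseteq> carrier (mpoly_ring V :: ('v, 'k) mpoly ring)"
    using \<N> prod_pvar_carrier[OF V(1), where 'k = 'k] by blast
  {
    define J where "J = {f \<in> carrier (mpoly_ring V :: ('v, 'k) mpoly ring).
      \<forall>m\<in>Poly_Mapping.keys f. \<exists>G\<in>\<N>. G \<subseteq> Poly_Mapping.keys m}"
    have l: "g * f \<in> J" if f: "f \<in> J" and g: "g \<in> carrier (mpoly_ring V)" for f g
    proof -
      have "\<exists>G\<in>\<N>. G \<subseteq> Poly_Mapping.keys m" if m: "m \<in> Poly_Mapping.keys (g * f)" for m
      proof -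
        obtain a b where ab: "b \<in> Poly_Mapping.keys f" "m = a + b"
          using m by (rule keys_multE)
        obtain G where "G \<in> \<N>" "G \<subseteq> Poly_Mapping.keys b"
          using f ab(1) unfolding J_def by blast
        then show ?thesis unfolding ab(2) keys_add_nat by blast
      qed
      moreover have "g * f \<in> carrier (mpoly_ring V)"
        using f g m_closed[of g f] unfolding J_def by simp
      ultimately show ?thesis unfolding J_def by blast
    qed
    have J: "ideal J (mpoly_ring V)"
    proof (rule idealI)
      show "subgroup J (add_monoid (mpoly_ring V))"
      proof (rule add.subgroupI)
        fix f assume f: "f \<in> J"
        then have *: "- f \<in> J" by (auto simp: J_def)
        have "\<ominus>\<^bsub>mpoly_ring V\<^esub> f = - f"
          using f * by (intro minus_equality) (auto simp: J_def)
        with * show "\<ominus>\<^bsub>mpoly_ring V\<^esub> f \<in> J" by simp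
      next
        fix f g assume "f \<in> J" "g \<in> J"
        then show "f \<oplus>\<^bsub>mpoly_ring V\<^esub> g \<in> J"
          using subsetD[OF keys_add[of f g]] unfolding J_def by simp blast
      next
        have "0 \<in> J" by (simp add: J_def)
        then show "J \<noteq> {}" by blast
      qed (auto simp: J_def)
    next
      fix f g :: "('v, 'k) mpoly" assume "f \<in> J" "g \<in> carrier (mpoly_ring V)"
      then have "g * f \<in> J" by (rule l)
      then show "g \<otimes>\<^bsub>mpoly_ring V\<^esub> f \<in> J" "f \<otimes>\<^bsub>mpoly_ring V\<^esub> g \<in> J"
        by (simp_all add: mult.commute)
    qed (rule ring_axioms)
    have "(\<lambda>G. \<Prod>v\<in>G. pvar v) ` \<N> \<subseteq> J"
    proof
      fix f assume "f \<in> (\<lambda>G. \<Prod>v\<in>G. pvar v :: ('v, 'k) mpoly) ` \<N>"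
      then obtain G where G: "G \<in> \<N>" "f = ?x G" by auto
      then have "finite G" using \<N> V finite_subset by blast
      then have "\<forall>m\<in>Poly_Mapping.keys f. G \<subseteq> Poly_Mapping.keys m"
        using keys_prod_pvar[of G _, where 'k = 'k] unfolding G(2) by blast
      moreover have "f \<in> carrier (mpoly_ring V)"
        unfolding G(2) by (rule subsetD[OF gens imageI[OF G(1)]])
      ultimately show "f \<in> J"
        using G(1) unfolding J_def by blast
    qed
    then have IJ: "?I \<subseteq> J" by (rule genideal_minimal[OF J])
    assume "?x F \<in> ?I"
    then have F: "?x F \<in> J" using IJ by blast
    obtain m where m: "?x F = Poly_Mapping.single m 1" "Poly_Mapping.keys m = F"
      using prod_pvar[of F, where 'k = 'k] V finite_subset by blast
    have "\<forall>m\<in>Poly_Mapping.keys (?x F). \<exists>G\<in>\<N>. G \<subseteq> Poly_Mapping.keys m"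
      using F by (simp add: J_def)
    then show "\<exists>G\<in>\<N>. G \<subseteq> F"
      unfolding m(1) using m(2) by simp
  }
  assume "\<exists>G\<in>\<N>. G \<subseteq> F"
  then obtain G where G: "G \<in> \<N>" "G \<subseteq> F" by blast
  have "?x G \<in> ?I" using genideal_self[OF gens] G(1) by blast
  moreover have "?x (F - G) \<in> carrier (mpoly_ring V)"
    using V by (intro prod_pvar_carrier) auto
  ultimately have "?x (F - G) \<otimes>\<^bsub>mpoly_ring V\<^esub> ?x G \<in> ?I"
    by (rule ideal.I_l_closed[OF genideal_ideal[OF gens]])
  moreover have "?x F = ?x (F - G) * ?x G"
    by (rule prod.subset_diff[OF G(2) finite_subset[OF V(2,1)]])
  ultimately show "?x F \<in> ?I" by simp
qed

lemma complex_of_squarefree_ideal_iff: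
  fixes V :: "'v set"
  assumes V: "finite V" and \<N>: "\<N> \<subseteq> Pow V"
  shows "simplicial_complex V \<Delta> \<and> stanley_reisner_ideal V \<Delta> =
           (genideal (mpoly_ring V) ((\<lambda>G. \<Prod>v\<in>G. pvar v) ` \<N>) :: ('v, 'k::field) mpoly set)
         \<longleftrightarrow> \<Delta> = {F. F \<subseteq> V \<and> \<not> (\<exists>G\<in>\<N>. G \<subseteq> F)}" (is "?A \<Delta> \<longleftrightarrow> \<Delta> = ?\<Delta>")
proof
  let ?I = "\<lambda>\<N>. genideal (mpoly_ring V) ((\<lambda>G. \<Prod>v\<in>G. pvar v :: ('v, 'k) mpoly) ` \<N>)"
  have SR: "stanley_reisner_ideal V \<Delta> = ?I (Pow V - \<Delta>)" for \<Delta>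
    unfolding stanley_reisner_ideal_def by (rule arg_cong[of _ _ "genideal _"]) auto
  {
    assume A: "?A \<Delta>"
    then have eq: "?I (Pow V - \<Delta>) = ?I \<N>" unfolding SR by (rule conjunct2)
    have *: "(\<exists>G\<in>Pow V - \<Delta>. G \<subseteq> F) \<longleftrightarrow> (\<exists>G\<in>\<N>. G \<subseteq> F)" if "F \<subseteq> V" for F
      using monomial_in_genideal_iff[OF V that \<N>, where 'k = 'k]
        monomial_in_genideal_iff[OF V that Diff_subset, of \<Delta>, where 'k = 'k]
      unfolding eq by (simp only:)
    have **: "(\<exists>G\<in>Pow V - \<Delta>. G \<subseteq> F) \<longleftrightarrow> F \<notin> \<Delta>" if "F \<subseteq> V" for F
      using A that unfolding simplicial_complex_def by blast
    have "\<Delta> \<subseteq> Pow V" using A unfolding simplicial_complex_def by blast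
    moreover have "F \<in> \<Delta> \<longleftrightarrow> \<not> (\<exists>G\<in>\<N>. G \<subseteq> F)" if "F \<subseteq> V" for F
      using *[OF that] **[OF that] by argo
    ultimately show "\<Delta> = ?\<Delta>" by auto
  }
  assume \<Delta>: "\<Delta> = ?\<Delta>"
  interpret cring "mpoly_ring V :: ('v, 'k) mpoly ring" by (rule cring_mpoly_ring)
  have gens: "(\<lambda>G. \<Prod>v\<in>G. pvar v) ` \<M> \<subseteq> carrier (mpoly_ring V :: ('v, 'k) mpoly ring)"
    if "\<M> \<subseteq> Pow V" for \<M>
    using that prod_pvar_carrier[OF V, where 'k = 'k] by blast
  have "?I (Pow V - \<Delta>) = ?I \<N>"
  proof
    show "?I (Pow V - \<Delta>) \<subseteq> ?I \<N>"
    proof (intro genideal_minimal genideal_ideal[OF gens] \<N> image_subsetI)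
      fix G assume "G \<in> Pow V - \<Delta>"
      then show "(\<Prod>v\<in>G. pvar v) \<in> ?I \<N>"
        by (subst monomial_in_genideal_iff[OF V _ \<N>]) (use \<Delta> in auto)
    qed
    show "?I \<N> \<subseteq> ?I (Pow V - \<Delta>)"
    proof (intro genideal_minimal genideal_ideal[OF gens] image_subsetI)
      fix G assume "G \<in> \<N>"
      then have "G \<in> Pow V - \<Delta>" using \<N> \<Delta> by blast
      then show "(\<Prod>v\<in>G. pvar v) \<in> ?I (Pow V - \<Delta>)"
        using genideal_self[OF gens[of "Pow V - \<Delta>"]] by blast
    qed auto
  qed
  moreover have "simplicial_complex V \<Delta>"
    unfolding simplicial_complex_def \<Delta> by blast
  ultimately show "?A \<Delta>" by (simp add: SR)
qed


section \<open>The Alexander dual of a finite meet-semilattice\<close>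

definition covers :: "'a::order \<Rightarrow> 'a \<Rightarrow> bool" where
  "covers b a \<longleftrightarrow> a < b \<and> (\<nexists>c. a < c \<and> c < b)"

definition join_irreducibles :: "'a::semilattice_inf set" where
  "join_irreducibles = {p. \<exists>!a. covers p a}"

definition ell :: "'a::semilattice_inf \<Rightarrow> 'a set" where
  "ell \<alpha> = {p \<in> join_irreducibles. p \<le> \<alpha>}"

definition poset_ideal :: "'a::semilattice_inf set \<Rightarrow> 'a set" where
  "poset_ideal B = {p \<in> join_irreducibles. \<exists>q\<in>B. p \<le> q}"

definition antichain :: "'a::order set \<Rightarrow> bool" where
  "antichain B \<longleftrightarrow> (\<forall>p\<in>B. \<forall>q\<in>B. p \<le> q \<longrightarrow> p = q)"

datatype 'a vertex = X 'a | Y 'a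

definition vertices :: "'a::semilattice_inf vertex set" where
  "vertices = X ` join_irreducibles \<union> Y ` join_irreducibles"

definition u_monomial :: "'a::semilattice_inf \<Rightarrow> ('a vertex, 'k::field) mpoly" where
  "u_monomial \<alpha> = (\<Prod>p\<in>ell \<alpha>. pvar (X p)) * (\<Prod>p\<in>join_irreducibles - ell \<alpha>. pvar (Y p))"

definition H_ideal :: "('a::semilattice_inf vertex, 'k::field) mpoly set" where
  "H_ideal = genideal (mpoly_ring vertices) (range u_monomial)"

text \<open>
  The type argument is the coefficient field, which the defining property refers to.  By
  \<open>Sigma_complex_unique\<close> below there is exactly one such complex, and it is the same for all
  fields.
\<close>

definition Sigma_complex :: "'k::field itself \<Rightarrow> 'a::{finite,semilattice_inf} vertex set set" where
  "Sigma_complex _ = (THE \<Delta>. simplicial_complex vertices \<Delta> \<and>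
     stanley_reisner_ideal vertices \<Delta> = (H_ideal :: ('a vertex, 'k) mpoly set))"

definition Gamma_complex :: "'k::field itself \<Rightarrow> 'a::{finite,semilattice_inf} vertex set set" where
  "Gamma_complex K = alexander_dual vertices (Sigma_complex K)"

lemma finite_vertices: "finite (vertices :: 'a::{finite,semilattice_inf} vertex set)"
  by (simp add: vertices_def)

lemma u_monomial_eq:
  fixes \<alpha> :: "'a::{finite,semilattice_inf}"
  shows "u_monomial \<alpha> = (\<Prod>v\<in>X ` ell \<alpha> \<union> Y ` (join_irreducibles - ell \<alpha>). pvar v)"
  unfolding u_monomial_def
  by (subst prod.union_disjoint) (auto simp: prod.reindex inj_on_def)

lemma Sigma_complex_unique:
  fixes \<Delta> :: "'a::{finite,semilattice_inf} vertex set set"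
  shows "simplicial_complex vertices \<Delta> \<and>
      stanley_reisner_ideal vertices \<Delta> = (H_ideal :: ('a vertex, 'k::field) mpoly set)
    \<longleftrightarrow> \<Delta> = {F. F \<subseteq> vertices \<and>
            \<not> (\<exists>\<alpha>. X ` ell \<alpha> \<union> Y ` (join_irreducibles - ell \<alpha>) \<subseteq> F)}"
proof -
  let ?N = "range (\<lambda>\<alpha>::'a. X ` ell \<alpha> \<union> Y ` (join_irreducibles - ell \<alpha>))"
  have "(H_ideal :: ('a vertex, 'k) mpoly set)
      = genideal (mpoly_ring vertices) ((\<lambda>G. \<Prod>v\<in>G. pvar v) ` ?N)"
    unfolding H_ideal_def image_image u_monomial_eq ..
  moreover have "?N \<subseteq> Pow vertices"
    by (auto simp: vertices_def ell_def)
  ultimately show ?thesis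
    using complex_of_squarefree_ideal_iff[OF finite_vertices, of ?N \<Delta>, where 'k = 'k] by simp
qed

lemma Sigma_complex_eq:
  "Sigma_complex TYPE('k::field) = {F. F \<subseteq> (vertices :: 'a::{finite,semilattice_inf} vertex set) \<and>
     \<not> (\<exists>\<alpha>. X ` ell \<alpha> \<union> Y ` (join_irreducibles - ell \<alpha>) \<subseteq> F)}"
  unfolding Sigma_complex_def Sigma_complex_unique by simp

lemma Gamma_complex_eq:
  "Gamma_complex TYPE('k::field) =
     {F :: 'a::{finite,semilattice_inf} vertex set.
        \<exists>\<alpha>. F \<subseteq> X ` (join_irreducibles - ell \<alpha>) \<union> Y ` ell \<alpha>}" (is "_ = ?R")
proof -
  have dual: "vertices - (X ` ell \<alpha> \<union> Y ` (join_irreducibles - ell \<alpha>))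
      = X ` (join_irreducibles - ell \<alpha>) \<union> Y ` ell \<alpha>" for \<alpha> :: 'a
    by (auto simp: vertices_def ell_def)
  have sub: "X ` ell \<alpha> \<union> Y ` (join_irreducibles - ell \<alpha>) \<subseteq> vertices" for \<alpha> :: 'a
    by (auto simp: vertices_def ell_def)
  have "F \<in> Gamma_complex TYPE('k) \<longleftrightarrow>
      (\<exists>\<alpha>. F \<subseteq> vertices - (X ` ell \<alpha> \<union> Y ` (join_irreducibles - ell \<alpha>)))"
    (is "_ \<longleftrightarrow> (\<exists>\<alpha>. F \<subseteq> vertices - ?U \<alpha>)") for F :: "'a vertex set"
  proof -
    have "F \<in> Gamma_complex TYPE('k) \<longleftrightarrow>
        (\<exists>G. F = vertices - G \<and> G \<subseteq> vertices \<and> (\<exists>\<alpha>. ?U \<alpha> \<subseteq> G))"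
      unfolding Gamma_complex_def alexander_dual_def Sigma_complex_eq by auto
    also have "\<dots> \<longleftrightarrow> (\<exists>\<alpha>. F \<subseteq> vertices - ?U \<alpha>)"
    proof
      assume "\<exists>\<alpha>. F \<subseteq> vertices - ?U \<alpha>"
      then obtain \<alpha> where \<alpha>: "F \<subseteq> vertices - ?U \<alpha>" ..
      then have "F = vertices - (vertices - F)" "?U \<alpha> \<subseteq> vertices - F"
        using sub[of \<alpha>] by auto
      then show "\<exists>G. F = vertices - G \<and> G \<subseteq> vertices \<and> (\<exists>\<alpha>. ?U \<alpha> \<subseteq> G)"
        by (intro exI[of _ "vertices - F"]) auto
    next
      assume "\<exists>G. F = vertices - G \<and> G \<subseteq> vertices \<and> (\<exists>\<alpha>. ?U \<alpha> \<subseteq> G)"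
      then obtain G \<alpha> where "F = vertices - G" "?U \<alpha> \<subseteq> G" by blast
      then have "F \<subseteq> vertices - ?U \<alpha>" by auto
      then show "\<exists>\<alpha>. F \<subseteq> vertices - ?U \<alpha>" ..
    qed
    finally show ?thesis .
  qed
  then show ?thesis unfolding dual by blast
qed

end

theory Submission
  imports Defs
begin

text \<open>
  Both sides are generated by squarefree monomials, so it suffices to see that the listed monomials
  detect exactly the nonfaces.  Given a vertex set \<open>F\<close> containing no listed monomial, let \<open>B\<close> be the
  maximal elements of \<open>{q. Y q \<in> F}\<close>.  Type (ii) gives an upper bound of \<open>B\<close>; let \<open>\<mu>\<close> be the
  meet of all of them.  Then \<open>F\<close> lies in the facet belonging to \<open>\<mu>\<close>: a vertex \<open>X p\<close> of \<open>F\<close> with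
  \<open>p \<le> \<mu>\<close> would produce a monomial of type (i) if \<open>p \<in> \<langle>B\<rangle>\<close> and of type (iii) otherwise.
\<close>

text \<open>Each \<open>ell \<alpha>\<close> is downward closed among the join-irreducibles.
  Conditions on the ideal generated by \<open>B\<close> thus become conditions on the
  \<open>Y\<close>-vertices of a face.\<close>

lemma subset_ell_iff_poset_ideal:
  assumes "B \<subseteq> join_irreducibles"
  shows "poset_ideal B \<subseteq> ell \<alpha> \<longleftrightarrow> B \<subseteq> ell \<alpha>"
  using assms by (auto simp: poset_ideal_def ell_def intro: order_trans)

text \<open>The maximal elements of \<open>C\<close> serve: by finiteness every element of
  \<open>C\<close> lies below one of them.\<close>

lemma antichain_generating_poset_ideal:
  fixes C :: "'a::semilattice_inf set"
  assumes "finite C"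
  obtains B where "B \<subseteq> C" "antichain B" "poset_ideal B = poset_ideal C"
proof
  let ?B = "{m \<in> C. \<forall>b\<in>C. m \<le> b \<longrightarrow> m = b}"
  show "?B \<subseteq> C" by blast
  show "antichain ?B" unfolding antichain_def by blast
  have "\<exists>m\<in>?B. q \<le> m" if "q \<in> C" for q
    using finite_has_maximal2[OF assms that] by blast
  then show "poset_ideal ?B = poset_ideal C"
    unfolding poset_ideal_def by (blast intro: order_trans)
qed

text \<open>A common lower bound of \<open>A\<close> lies below its meet. The set has to be nonempty
  because \<open>Inf_fin {}\<close> has no specified value.\<close>

lemma subset_ell_Inf_fin:
  fixes B :: "'a::{finite,semilattice_inf} set"
  assumes "A \<noteq> {}" "\<And>\<alpha>. \<alpha> \<in> A \<Longrightarrow> B \<subseteq> ell \<alpha>"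
  shows "B \<subseteq> ell (Inf_fin A)"
proof
  fix q assume "q \<in> B"
  then have "q \<in> ell \<alpha>" if "\<alpha> \<in> A" for \<alpha>
    using assms(2) that by blast
  then show "q \<in> ell (Inf_fin A)"
    using assms(1) by (auto simp: ell_def intro!: Inf_fin.boundedI)
qed

lemma ell_mono: "\<alpha> \<le> \<beta> \<Longrightarrow> ell \<alpha> \<subseteq> ell \<beta>"
  by (auto simp: ell_def)

text \<open>Vertex sets instead of monomials: divisibility becomes inclusion, and the comparison
  with faces involves no polynomials. The existence clause in the third family makes its meet range
  over a nonempty set.\<close>

definition generator_supports :: "'a::{finite,semilattice_inf} vertex set set" where
  "generator_supports =
     {{X p, Y q} | p q. p \<in> join_irreducibles \<and> q \<in> join_irreducibles \<and> p \<le> q}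
     \<union> {Y ` B | B. B \<subseteq> join_irreducibles \<and> antichain B \<and> (\<forall>\<alpha>. \<not> poset_ideal B \<subseteq> ell \<alpha>)}
     \<union> {insert (X p) (Y ` B) | p B. B \<subseteq> join_irreducibles \<and> antichain B \<and>
          (\<forall>\<beta>. ell \<beta> \<noteq> poset_ideal B) \<and> (\<exists>\<alpha>. poset_ideal B \<subseteq> ell \<alpha>) \<and>
          p \<in> ell (Inf_fin {\<alpha>. poset_ideal B \<subseteq> ell \<alpha>}) - poset_ideal B}"

lemma generator_supportsI1:
  "p \<in> join_irreducibles \<Longrightarrow> q \<in> join_irreducibles \<Longrightarrow> p \<le> q \<Longrightarrow> {X p, Y q} \<in> generator_supports"
  unfolding generator_supports_def by (intro UnI1 CollectI exI[of _ p] exI[of _ q]) simp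

lemma generator_supportsI2:
  "B \<subseteq> join_irreducibles \<Longrightarrow> antichain B \<Longrightarrow> (\<And>\<alpha>. \<not> poset_ideal B \<subseteq> ell \<alpha>) \<Longrightarrow>
     Y ` B \<in> generator_supports"
  unfolding generator_supports_def by blast

lemma generator_supportsI3:
  "B \<subseteq> join_irreducibles \<Longrightarrow> antichain B \<Longrightarrow> (\<And>\<beta>. ell \<beta> \<noteq> poset_ideal B) \<Longrightarrow>
     poset_ideal B \<subseteq> ell \<alpha> \<Longrightarrow> p \<in> ell (Inf_fin {\<alpha>. poset_ideal B \<subseteq> ell \<alpha>}) - poset_ideal B \<Longrightarrow>
     insert (X p) (Y ` B) \<in> generator_supports"
  unfolding generator_supports_def by blast

lemma generator_supportsE:
  assumes "G \<in> generator_supports"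
  obtains
    (XY) p q where "G = {X p, Y q}" "p \<in> join_irreducibles" "q \<in> join_irreducibles" "p \<le> q"
  | (Y) B where "G = Y ` B" "B \<subseteq> join_irreducibles" "\<And>\<alpha>. \<not> poset_ideal B \<subseteq> ell \<alpha>"
  | (XYs) p B where "G = insert (X p) (Y ` B)" "B \<subseteq> join_irreducibles"
      "p \<in> ell (Inf_fin {\<alpha>. poset_ideal B \<subseteq> ell \<alpha>})"
  using assms unfolding generator_supports_def Un_iff mem_Collect_eq
  by (elim disjE exE conjE) (metis that(1), metis that(2), metis DiffD1 that(3))

lemma generator_supports_subset: "generator_supports \<subseteq> Pow vertices"
proof
  fix G :: "'a vertex set" assume "G \<in> generator_supports"
  then show "G \<in> Pow vertices"
    by (cases rule: generator_supportsE) (auto simp: vertices_def ell_def)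
qed

text \<open>\<open>X\<close> and \<open>Y\<close> are injective with disjoint ranges, so no variable
  is repeated and the product over a support splits as displayed.\<close>

lemma prod_pvar_generator_supports:
  "(\<lambda>G. \<Prod>v\<in>G. pvar v :: ('a::{finite,semilattice_inf} vertex, 'k::field) mpoly) ` generator_supports =
     {pvar (X p) * pvar (Y q) | p q. p \<in> join_irreducibles \<and> q \<in> join_irreducibles \<and> p \<le> q}
      \<union> {\<Prod>q\<in>B. pvar (Y q) | B. B \<subseteq> join_irreducibles \<and> antichain B \<and>
            (\<forall>\<alpha>. \<not> poset_ideal B \<subseteq> ell \<alpha>)}
      \<union> {pvar (X p) * (\<Prod>q\<in>B. pvar (Y q)) | p B. B \<subseteq> join_irreducibles \<and> antichain B \<and>
            (\<forall>\<beta>. ell \<beta> \<noteq> poset_ideal B) \<and>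
            (\<exists>\<alpha>. poset_ideal B \<subseteq> ell \<alpha>) \<and>
            p \<in> ell (Inf_fin {\<alpha>. poset_ideal B \<subseteq> ell \<alpha>}) - poset_ideal B}"
proof -
  let ?m = "\<lambda>G. \<Prod>v\<in>G. pvar v :: ('a vertex, 'k) mpoly"
  have XY: "?m {X p, Y q} = pvar (X p) * pvar (Y q)" for p q
    by simp
  have Y: "?m (Y ` B) = (\<Prod>q\<in>B. pvar (Y q))" for B
    by (simp add: prod.reindex inj_on_def)
  have XYs: "?m (insert (X p) (Y ` B)) = pvar (X p) * (\<Prod>q\<in>B. pvar (Y q))" for p B
    by (subst prod.insert) (auto simp: Y)
  have image1: "f ` {g B | B. P B} = {f (g B) | B. P B}"
    for f :: "'a vertex set \<Rightarrow> ('a vertex, 'k) mpoly" and g :: "'a set \<Rightarrow> _" and P by blast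
  \<comment> \<open>The type of \<open>b\<close> stays generic: it is an element \<open>q\<close> in
    family (i) and a set \<open>B\<close> in family (iii).\<close>
  have image2: "f ` {g p b | p b. P p b} = {f (g p b) | p b. P p b}"
    for f :: "'a vertex set \<Rightarrow> ('a vertex, 'k) mpoly" and g :: "'a \<Rightarrow> 'b \<Rightarrow> _" and P by blast
  show ?thesis
    unfolding generator_supports_def image_Un image1 image2 XY Y XYs ..
qed

lemma Gamma_complex_generator_supports:
  "Gamma_complex TYPE('k::field) =
     {F. F \<subseteq> (vertices :: 'a::{finite,semilattice_inf} vertex set) \<and>
         \<not> (\<exists>G\<in>generator_supports. G \<subseteq> F)}"
proof (rule Set.set_eqI)
  fix F :: "'a vertex set"
  let ?facet = "\<lambda>\<alpha>. X ` (join_irreducibles - ell \<alpha>) \<union> Y ` ell \<alpha>"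
  \<comment> \<open>First half: every listed support is a nonface, since no facet contains
    it.\<close>
  have "\<not> G \<subseteq> ?facet \<alpha>" if "G \<in> generator_supports" for G :: "'a vertex set" and \<alpha>
    using that
  proof (cases rule: generator_supportsE)
    case (XY p q)
    then show ?thesis by (auto simp: ell_def)
  next
    case (Y B)
    have "\<not> B \<subseteq> ell \<alpha>"
      using Y(3) unfolding subset_ell_iff_poset_ideal[OF Y(2)] .
    then show ?thesis using Y(1) by auto
  next
    case (XYs p B)
    show ?thesis
    proof
      assume "G \<subseteq> ?facet \<alpha>"
      then have "B \<subseteq> ell \<alpha>" and p: "p \<notin> ell \<alpha>"
        using XYs(1) by auto
      \<comment> \<open>Now \<open>\<alpha>\<close> is one of the elements whose meet is taken, so
        \<open>p\<close>, lying below the meet, also lies below \<open>\<alpha>\<close>.\<close>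
      then have "Inf_fin {\<alpha>. poset_ideal B \<subseteq> ell \<alpha>} \<le> \<alpha>"
        by (intro Inf_fin.coboundedI) (simp_all add: subset_ell_iff_poset_ideal[OF XYs(2)])
      then show False using ell_mono XYs(3) p by blast
    qed
  qed
  moreover have "?facet \<alpha> \<subseteq> vertices" for \<alpha> :: 'a
    by (auto simp: vertices_def ell_def)
  moreover have "\<exists>\<alpha>. F \<subseteq> ?facet \<alpha>"
    if F: "F \<subseteq> vertices" and free: "\<And>G. G \<in> generator_supports \<Longrightarrow> \<not> G \<subseteq> F"
  proof -
    define C where "C = {q. Y q \<in> F}"
    have C: "C \<subseteq> join_irreducibles"
      using F by (auto simp: C_def vertices_def)
    obtain B where B: "B \<subseteq> C" "antichain B" "poset_ideal B = poset_ideal C"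
      using antichain_generating_poset_ideal[of C] by auto
    have BF: "Y ` B \<subseteq> F" and BP: "B \<subseteq> join_irreducibles"
      using B(1) C by (auto simp: C_def)
    let ?A = "{\<alpha>. poset_ideal B \<subseteq> ell \<alpha>}"
    obtain \<alpha> where \<alpha>: "poset_ideal B \<subseteq> ell \<alpha>"
      using generator_supportsI2[OF BP B(2)] free BF by blast
    define \<mu> where "\<mu> = Inf_fin ?A"
    have \<mu>: "poset_ideal B \<subseteq> ell \<mu>"
      unfolding \<mu>_def using \<alpha> by (intro subset_ell_Inf_fin) auto
    \<comment> \<open>The facet must contain every \<open>Y q\<close> in \<open>F\<close>, not only
      those with \<open>q\<close> maximal; the common ideal carries the bound from \<open>B\<close>
      back to \<open>C\<close>.\<close>
    then have "C \<subseteq> ell \<mu>"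
      unfolding B(3) subset_ell_iff_poset_ideal[OF C] .
    moreover have "p \<notin> ell \<mu>" if p: "X p \<in> F" for p
    proof
      assume p\<mu>: "p \<in> ell \<mu>"
      show False
      proof (cases "p \<in> poset_ideal B")
        case True
        then obtain q where "q \<in> B" "p \<in> join_irreducibles" "p \<le> q"
          by (auto simp: poset_ideal_def)
        then show False
          using generator_supportsI1[of p q] free[of "{X p, Y q}"] p BF BP by blast
      next
        case False
        \<comment> \<open>The element \<open>p\<close> itself rules out equality: it would give
          \<open>\<mu> \<le> \<beta>\<close>, hence put \<open>p\<close> into
          \<open>ell \<beta>\<close>, that is, into \<open>poset_ideal B\<close>.\<close>
        have "ell \<beta> \<noteq> poset_ideal B" for \<beta>
        proof
          assume \<beta>: "ell \<beta> = poset_ideal B"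
          then have "\<mu> \<le> \<beta>"
            unfolding \<mu>_def by (intro Inf_fin.coboundedI) simp_all
          then show False using ell_mono p\<mu> False \<beta> by blast
        qed
        then have "insert (X p) (Y ` B) \<in> generator_supports"
          using p\<mu> False unfolding \<mu>_def by (intro generator_supportsI3[OF BP B(2) _ \<alpha>]) auto
        then show False using free p BF by blast
      qed
    qed
    moreover have "v \<in> X ` join_irreducibles \<union> Y ` C" if "v \<in> F" for v
      using that F by (cases v) (auto simp: C_def vertices_def)
    ultimately have "F \<subseteq> ?facet \<mu>" by blast
    then show ?thesis ..
  qed
  ultimately show "F \<in> Gamma_complex TYPE('k) \<longleftrightarrow>
      F \<in> {F. F \<subseteq> vertices \<and> \<not> (\<exists>G\<in>generator_supports. G \<subseteq> F)}"
    unfolding Gamma_complex_eq mem_Collect_eq by (meson order_trans)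
qed

theorem theorem2p1:
  shows "(stanley_reisner_ideal vertices (Gamma_complex TYPE('k))
            :: ('a::{finite,semilattice_inf} vertex, 'k::field) mpoly set) =
    genideal (mpoly_ring vertices)
     ({pvar (X p) * pvar (Y q) | p q. p \<in> join_irreducibles \<and> q \<in> join_irreducibles \<and> p \<le> q}
      \<union> {\<Prod>q\<in>B. pvar (Y q) | B. B \<subseteq> join_irreducibles \<and> antichain B \<and>
            (\<forall>\<alpha>. \<not> poset_ideal B \<subseteq> ell \<alpha>)}
      \<union> {pvar (X p) * (\<Prod>q\<in>B. pvar (Y q)) | p B. B \<subseteq> join_irreducibles \<and> antichain B \<and>
            (\<forall>\<beta>. ell \<beta> \<noteq> poset_ideal B) \<and>
            (\<exists>\<alpha>. poset_ideal B \<subseteq> ell \<alpha>) \<and>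
            p \<in> ell (Inf_fin {\<alpha>. poset_ideal B \<subseteq> ell \<alpha>}) - poset_ideal B})"
  \<comment> \<open>Once the generators are products over supports, the description of
    \<open>Gamma_complex\<close> by forbidden subsets determines its Stanley-Reisner ideal.\<close>
  unfolding prod_pvar_generator_supports[symmetric]
  using Gamma_complex_generator_supports
    complex_of_squarefree_ideal_iff[OF finite_vertices generator_supports_subset]
  by (rule conjunct2[OF iffD2, rotated])

end
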